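(* Let $H$ be a separable complex Hilbert space and let $M_1$ and $M_2$ be two closed subspaces of $H$ such that $M_1\neq H$ or $M_2\neq H$. If $P_{M_1}P_{M_2}P_{M_1}$ is diagonalizable, then $$W(P_{M_2}P_{M_1})=\mathrm{conv}\Big(\bigcup_{\lambda\in\sigma_p(P_{M_2}P_{M_1})}\mathscr{E}(\lambda)\Big).$$
   Context: For a closed subspace $M$ of $H$, $P_M$ denotes the orthogonal projection of $H$ onto $M$. For a bounded operator $T$ on $H$, $\sigma_p(T)$ is its point spectrum (set of eigenvalues) and $W(T)=\{\langle Tx,x\rangle : x\in H,\ \|x\|=1\}\subset\mathbb{C}$ is its numerical range. The operator $P_{M_1}P_{M_2}P_{M_1}$ is called diagonalizable if there exist a (countable) orthonormal basis $(\tilde h_n)_n$ of $H$ and scalars $(\tilde\lambda_n)_n$ such that $P_{M_1}P_{M_2}P_{M_1}x=\sum_n\tilde\lambda_n\langle x,\tilde h_n\rangle\tilde h_n$ for all $x\in H$. The spectrum of a product of two orthogonal projections is contained in $[0,1]$. For $\lambda\in[0,1]$, $\mathscr{E}(\lambda)\subset\mathbb{C}$ denotes the (closed) domain delimited by the ellipse with foci $0$ and $\lambda$ and minor axis (full) length $\sqrt{\lambda(1-\lambda)}$; that is, for $0<\lambda<1$, $\mathscr{E}(\lambda)=\{x+iy: x,y\in\mathbb{R},\ \frac{(x-\lambda/2)^2}{\lambda/4}+\frac{y^2}{\lambda(1-\lambda)/4}\le 1\}$, and $\mathscr{E}(0)=\{0\}$, $\mathscr{E}(1)=[0,1]$. $\mathrm{conv}(E)$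 is the convex hull of $E\subset\mathbb{C}$ (no closure is taken). *)

theory Defs
  imports "HOL-Analysis.Analysis"
begin

section \<open>Complex Hilbert spaces\<close>

text \<open>The inner product is linear in the first argument. Scaling by a real number is the
  scaling of the underlying real Banach space, whose norm is the one given by the inner product;
  positive definiteness follows from the norm axioms.\<close>

class complex_hilbert_space = banach +
  fixes scaleC :: "complex \<Rightarrow> 'a \<Rightarrow> 'a"  (infixr "*\<^sub>C" 75)
    and cinner :: "'a \<Rightarrow> 'a \<Rightarrow> complex"
  assumes scaleC_add_right: "c *\<^sub>C (x + y) = c *\<^sub>C x + c *\<^sub>C y"
    and scaleC_add_left: "(c + d) *\<^sub>C x = c *\<^sub>C x + d *\<^sub>C x"
    and scaleC_scaleC: "c *\<^sub>C (d *\<^sub>C x) = (c * d) *\<^sub>C x"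
    and scaleR_eq_scaleC: "r *\<^sub>R x = complex_of_real r *\<^sub>C x"
    and cinner_commute: "cinner x y = cnj (cinner y x)"
    and cinner_add_left: "cinner (x + y) z = cinner x z + cinner y z"
    and cinner_scaleC_left: "cinner (c *\<^sub>C x) y = c * cinner x y"
    and cinner_self: "cinner x x = complex_of_real ((norm x)\<^sup>2)"

lemma scaleC_one: "1 *\<^sub>C x = x"
  for x :: "'a :: complex_hilbert_space"
  by (metis scaleR_eq_scaleC scaleR_one of_real_1)

global_interpretation complex_vector:
  vector_space "scaleC :: complex \<Rightarrow> 'a \<Rightarrow> 'a :: complex_hilbert_space"
  by (unfold_locales; rule scaleC_add_right scaleC_add_left scaleC_scaleC scaleC_one)

instantiation complex :: complex_hilbert_space
begin

definition scaleC_complex :: "complex \<Rightarrow> complex \<Rightarrow> complex"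
  where "scaleC_complex c x = c * x"

definition cinner_complex :: "complex \<Rightarrow> complex \<Rightarrow> complex"
  where "cinner_complex x y = x * cnj y"

instance
proof
  fix c d x y z :: complex and r :: real
  show "c *\<^sub>C (x + y) = c *\<^sub>C x + c *\<^sub>C y" "(c + d) *\<^sub>C x = c *\<^sub>C x + d *\<^sub>C x"
    "cinner (x + y) z = cinner x z + cinner y z"
    unfolding scaleC_complex_def cinner_complex_def by (rule distrib_left distrib_right)+
  show "c *\<^sub>C (d *\<^sub>C x) = (c * d) *\<^sub>C x" "cinner (c *\<^sub>C x) y = c * cinner x y"
    unfolding scaleC_complex_def cinner_complex_def by (simp_all only: mult.assoc)
  show "r *\<^sub>R x = complex_of_real r *\<^sub>C x"
    unfolding scaleC_complex_def by (rule scaleR_conv_of_real)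
  show "cinner x y = cnj (cinner y x)"
    unfolding cinner_complex_def by simp
  show "cinner x x = complex_of_real ((norm x)\<^sup>2)"
    unfolding cinner_complex_def by (rule complex_norm_square[symmetric])
qed

end

lemma cinner_add_right: "cinner x (y + z) = cinner x y + cinner x z"
  for x y z :: "'a :: complex_hilbert_space"
  unfolding cinner_commute[of x "y + z"] cinner_add_left complex_cnj_add
  by (simp only: cinner_commute[of x y] cinner_commute[of x z])

lemma cinner_scaleC_right: "cinner x (c *\<^sub>C y) = cnj c * cinner x y"
  for x y :: "'a :: complex_hilbert_space"
  unfolding cinner_commute[of x "c *\<^sub>C y"] cinner_scaleC_left complex_cnj_mult
  by (simp only: cinner_commute[of x y])

lemma cinner_zero_left [simp]: "cinner 0 x = 0"
  for x :: "'a :: complex_hilbert_space"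
  using cinner_add_left[of 0 0 x] by simp

lemma cinner_zero_right [simp]: "cinner x 0 = 0"
  for x :: "'a :: complex_hilbert_space"
  using cinner_add_right[of x 0 0] by simp

lemma cinner_diff_left: "cinner (x - y) z = cinner x z - cinner y z"
  for x y z :: "'a :: complex_hilbert_space"
  using cinner_add_left[of "x - y" y z] by simp

lemma cinner_diff_right: "cinner x (y - z) = cinner x y - cinner x z"
  for x y z :: "'a :: complex_hilbert_space"
  using cinner_add_right[of x "y - z" z] by simp

lemma Re_cinner_self: "Re (cinner x x) = (norm x)\<^sup>2"
  for x :: "'a :: complex_hilbert_space"
  unfolding cinner_self by (rule Re_complex_of_real)

lemma norm_scaleC: "norm (c *\<^sub>C x) = cmod c * norm x"
  for x :: "'a :: complex_hilbert_space"
proof -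
  have "complex_of_real ((norm (c *\<^sub>C x))\<^sup>2) = (c * cnj c) * cinner x x"
    unfolding cinner_self[symmetric] cinner_scaleC_right cinner_scaleC_left by (simp only: ac_simps)
  also have "\<dots> = complex_of_real ((cmod c * norm x)\<^sup>2)"
    unfolding cinner_self complex_norm_square[symmetric] power_mult_distrib of_real_mult ..
  finally have "(norm (c *\<^sub>C x))\<^sup>2 = (cmod c * norm x)\<^sup>2"
    by (simp only: of_real_eq_iff)
  then show ?thesis
    by (rule power2_eq_imp_eq) simp_all
qed

lemma norm_add_square: "(norm (x + y))\<^sup>2 = (norm x)\<^sup>2 + 2 * Re (cinner x y) + (norm y)\<^sup>2"
  for x y :: "'a :: complex_hilbert_space"
proof -
  have "complex_of_real ((norm (x + y))\<^sup>2) = cinner (x + y) (x + y)"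
    by (simp only: cinner_self)
  also have "\<dots> = cinner x x + (cinner x y + cnj (cinner x y)) + cinner y y"
    using cinner_commute[of y x] by (simp add: cinner_add_left cinner_add_right)
  finally have "Re (complex_of_real ((norm (x + y))\<^sup>2)) =
      Re (cinner x x + (cinner x y + cnj (cinner x y)) + cinner y y)"
    by simp
  then show ?thesis
    by (simp add: Re_cinner_self del: of_real_power)
qed

lemma norm_diff_square: "(norm (x - y))\<^sup>2 = (norm x)\<^sup>2 - 2 * Re (cinner x y) + (norm y)\<^sup>2"
  for x y :: "'a :: complex_hilbert_space"
  using norm_add_square[of "x - y" y] by (simp add: cinner_diff_left Re_cinner_self)


section \<open>Orthogonal projections\<close>

definition closed_csubspace :: "'a :: complex_hilbert_space set \<Rightarrow> bool"
  where "closed_csubspace M \<longleftrightarrow> complex_vector.subspace M \<and> closed M"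

definition proj :: "'a :: complex_hilbert_space set \<Rightarrow> 'a \<Rightarrow> 'a"
  where "proj M x = (THE y. y \<in> M \<and> (\<forall>z\<in>M. cinner (x - y) z = 0))"

lemma minimizer_orthogonal:
  fixes M :: "'a :: complex_hilbert_space set"
  assumes M: "complex_vector.subspace M" and y: "y \<in> M" and z: "z \<in> M"
    and min: "\<And>w. w \<in> M \<Longrightarrow> norm (x - y) \<le> norm (x - w)"
  shows "cinner (x - y) z = 0"
proof (cases "z = 0")
  case False
  define a where "a = cinner (x - y) z / complex_of_real ((norm z)\<^sup>2)"
  have a: "cinner (x - y) z = a * complex_of_real ((norm z)\<^sup>2)"
    using False by (simp add: a_def)
  have "y + a *\<^sub>C z \<in> M"
    using M y z by (simp add: complex_vector.subspace_add complex_vector.subspace_scale)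
  from min[OF this] have "(norm (x - y))\<^sup>2 \<le> (norm ((x - y) - a *\<^sub>C z))\<^sup>2"
    by (simp add: power_mono diff_diff_add)
  also have "\<dots> = (norm (x - y))\<^sup>2 - 2 * Re (cinner (x - y) (a *\<^sub>C z)) + (norm (a *\<^sub>C z))\<^sup>2"
    by (rule norm_diff_square)
  also have "cinner (x - y) (a *\<^sub>C z) = complex_of_real ((cmod a)\<^sup>2 * (norm z)\<^sup>2)"
    by (simp only: cinner_scaleC_right a of_real_mult complex_norm_square) (simp add: ac_simps)
  also have "(norm (a *\<^sub>C z))\<^sup>2 = (cmod a)\<^sup>2 * (norm z)\<^sup>2"
    by (simp add: norm_scaleC power_mult_distrib)
  finally have "(cmod a)\<^sup>2 * (norm z)\<^sup>2 \<le> 0"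
    by (simp add: mult.commute)
  then have "a = 0"
    using False by (simp add: mult_le_0_iff power2_less_0 not_less)
  then show ?thesis
    using a by simp
qed simp

lemma ex1_proj:
  fixes M :: "'a :: complex_hilbert_space set"
  assumes "closed_csubspace M"
  shows "\<exists>!y. y \<in> M \<and> (\<forall>z\<in>M. cinner (x - y) z = 0)"
proof -
  have sub: "complex_vector.subspace M" and cl: "closed M"
    using assms by (auto simp: closed_csubspace_def)
  have ne: "M \<noteq> {}"
    using complex_vector.subspace_0[OF sub] by auto
  define d where "d = infdist x M"
  have d: "d \<le> norm (x - w)" if "w \<in> M" for w
    using infdist_le[OF that, of x] by (simp add: d_def dist_norm)
  have d0: "0 \<le> d"
    by (simp add: d_def infdist_nonneg)
  define S where "S n = {w \<in> M. (norm (x - w))\<^sup>2 \<le> d\<^sup>2 + 1 / real (Suc n)}" for n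
  have "\<exists>y. \<Inter>(range S) = {y}"
  proof (rule decreasing_closed_nest_sing)
    fix n
    have "S n = M \<inter> {w. (norm (x - w))\<^sup>2 \<le> d\<^sup>2 + 1 / real (Suc n)}"
      by (auto simp: S_def)
    then show "closed (S n)"
      using cl by (auto intro!: closed_Int closed_Collect_le continuous_intros)
    have "d < sqrt (d\<^sup>2 + 1 / real (Suc n))"
      by (rule real_less_rsqrt) simp
    then have "\<exists>w\<in>M. dist x w < sqrt (d\<^sup>2 + 1 / real (Suc n))"
      using ne by (subst (asm) d_def) (auto simp: infdist_def cINF_less_iff)
    then obtain w where w: "w \<in> M" "norm (x - w) < sqrt (d\<^sup>2 + 1 / real (Suc n))"
      by (auto simp: dist_norm)
    then have "(norm (x - w))\<^sup>2 \<le> (sqrt (d\<^sup>2 + 1 / real (Suc n)))\<^sup>2"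
      by (intro power_mono) auto
    also have "\<dots> = d\<^sup>2 + 1 / real (Suc n)"
      by simp
    finally show "S n \<noteq> {}"
      using w by (auto simp: S_def)
  next
    fix m n :: nat assume "m \<le> n"
    then have "1 / real (Suc n) \<le> 1 / real (Suc m)"
      by (simp add: field_simps)
    then show "S n \<subseteq> S m"
      by (auto simp: S_def)
  next
    fix e :: real assume e: "0 < e"
    obtain n where n: "4 / e\<^sup>2 < real n"
      using reals_Archimedean2 by blast
    then have "4 / e\<^sup>2 < real (Suc n)"
      by simp
    then have small: "4 * (1 / real (Suc n)) < e\<^sup>2"
      using e by (simp add: field_simps)
    have "dist v w < e" if "v \<in> S n" "w \<in> S n" for v w
    proof -
      have vw: "v \<in> M" "w \<in> M" "(norm (x - v))\<^sup>2 \<le> d\<^sup>2 + 1 / real (Suc n)"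
        "(norm (x - w))\<^sup>2 \<le> d\<^sup>2 + 1 / real (Suc n)"
        using that by (auto simp: S_def)
      have half: "complex_of_real (1/2) *\<^sub>C (v + w) \<in> M"
        using sub vw by (simp add: complex_vector.subspace_add complex_vector.subspace_scale)
      have "(x - v) + (x - w) = 2 *\<^sub>R (x - (1/2) *\<^sub>R (v + w))"
        by (simp add: scaleR_right_diff_distrib scaleR_2 algebra_simps)
      then have "norm ((x - v) + (x - w)) = 2 * norm (x - (1/2) *\<^sub>R (v + w))"
        by simp
      moreover have "d \<le> norm (x - (1/2) *\<^sub>R (v + w))"
        using d[OF half] by (simp only: scaleR_eq_scaleC)
      ultimately have "(2 * d)\<^sup>2 \<le> (norm ((x - v) + (x - w)))\<^sup>2"
        using d0 by (intro power_mono) auto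
      moreover have "(norm ((x - v) + (x - w)))\<^sup>2 + (norm ((x - v) - (x - w)))\<^sup>2 =
          2 * (norm (x - v))\<^sup>2 + 2 * (norm (x - w))\<^sup>2"
        unfolding norm_add_square norm_diff_square[of "x - v"] by simp
      moreover have "(2 * d)\<^sup>2 = 4 * d\<^sup>2"
        by (simp add: power_mult_distrib)
      ultimately have "(norm ((x - v) - (x - w)))\<^sup>2 \<le> 4 * (1 / real (Suc n))"
        using vw(3,4) by linarith
      then have "(norm (w - v))\<^sup>2 < e\<^sup>2"
        using small by simp
      then show ?thesis
        using e by (simp add: dist_norm norm_minus_commute power_less_imp_less_base)
    qed
    then show "\<exists>n. \<forall>v\<in>S n. \<forall>w\<in>S n. dist v w < e"
      by blast
  qed
  then obtain y where "\<And>n. y \<in> S n"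
    by blast
  then have y: "y \<in> M" and le: "\<And>n. (norm (x - y))\<^sup>2 \<le> d\<^sup>2 + 1 / real (Suc n)"
    by (auto simp: S_def)
  have "(norm (x - y))\<^sup>2 \<le> d\<^sup>2"
  proof (rule field_le_epsilon)
    fix e :: real assume "0 < e"
    then obtain n where "1 / real (Suc n) < e"
      using nat_approx_posE by metis
    then show "(norm (x - y))\<^sup>2 \<le> d\<^sup>2 + e"
      using le[of n] by simp
  qed
  then have xy: "norm (x - y) \<le> d"
    using d0 by (rule power2_le_imp_le)
  have orth: "cinner (x - y) z = 0" if "z \<in> M" for z
    by (rule minimizer_orthogonal[OF sub y that]) (rule order_trans[OF xy d])
  have "u = y" if u: "u \<in> M" "\<forall>z\<in>M. cinner (x - u) z = 0" for u
  proof -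
    have m: "u - y \<in> M"
      using sub u(1) y by (rule complex_vector.subspace_diff)
    have "cinner (u - y) (u - y) = cinner ((x - y) - (x - u)) (u - y)"
      by simp
    also have "\<dots> = 0"
      unfolding cinner_diff_left[of "x - y"] using m u(2) orth by simp
    finally show ?thesis
      by (simp add: cinner_self)
  qed
  then show ?thesis
    using y orth by blast
qed

lemma proj_in: "closed_csubspace M \<Longrightarrow> proj M x \<in> M"
  and cinner_proj: "closed_csubspace M \<Longrightarrow> z \<in> M \<Longrightarrow> cinner (x - proj M x) z = 0"
  unfolding proj_def using theI'[OF ex1_proj, of M x] by blast+


section \<open>Point spectrum, numerical range, diagonalizability\<close>

definition point_spectrum :: "('a :: complex_hilbert_space \<Rightarrow> 'a) \<Rightarrow> complex set"
  where "point_spectrum T = {\<mu>. \<exists>x. x \<noteq> 0 \<and> T x = \<mu> *\<^sub>C x}"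

definition numerical_range :: "('a :: complex_hilbert_space \<Rightarrow> 'a) \<Rightarrow> complex set"
  where "numerical_range T = {cinner (T x) x | x. norm x = 1}"

text \<open>A countable family is indexed by a set of natural numbers, so that finite-dimensional
  spaces are covered.\<close>

definition orthonormal_basis_on :: "nat set \<Rightarrow> (nat \<Rightarrow> 'a :: complex_hilbert_space) \<Rightarrow> bool"
  where "orthonormal_basis_on I h \<longleftrightarrow>
    (\<forall>m\<in>I. \<forall>n\<in>I. cinner (h m) (h n) = (if m = n then 1 else 0)) \<and>
    closure (complex_vector.span (h ` I)) = UNIV"

definition diagonalizable :: "('a :: complex_hilbert_space \<Rightarrow> 'a) \<Rightarrow> bool"
  where "diagonalizable T \<longleftrightarrow>
    (\<exists>I h c. orthonormal_basis_on I h \<and>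
      (\<forall>x. ((\<lambda>n. (c n * cinner x (h n)) *\<^sub>C h n) has_sum T x) I))"

text \<open>The elliptical domain with foci 0 and l and minor axis of full length
  sqrt (l * (1 - l)). It is only meaningful for l in [0,1], which suffices for products of two
  orthogonal projections, see \<open>point_spectrum_proj_proj\<close> below.\<close>

definition elliptic_domain :: "real \<Rightarrow> complex set"
  where "elliptic_domain l =
    (if l = 0 then {0}
     else if l = 1 then complex_of_real ` {0..1}
     else {z. (Re z - l / 2)\<^sup>2 / (l / 4) + (Im z)\<^sup>2 / (l * (1 - l) / 4) \<le> 1})"

lemma point_spectrum_proj_proj:
  fixes M1 M2 :: "'a :: complex_hilbert_space set"
  assumes "closed_csubspace M1" "closed_csubspace M2"
  shows "point_spectrum (proj M2 \<circ> proj M1) \<subseteq> complex_of_real ` {0..1}"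
proof
  fix \<mu> assume "\<mu> \<in> point_spectrum (proj M2 \<circ> proj M1)"
  then obtain x where x: "x \<noteq> 0" "proj M2 (proj M1 x) = \<mu> *\<^sub>C x"
    by (auto simp: point_spectrum_def)
  show "\<mu> \<in> complex_of_real ` {0..1}"
  proof (cases "\<mu> = 0")
    case False
    define y where "y = proj M1 x"
    have "inverse \<mu> *\<^sub>C (\<mu> *\<^sub>C x) \<in> M2"
      using assms(2) proj_in[OF assms(2), of "proj M1 x"] x(2)
      by (metis closed_csubspace_def complex_vector.subspace_scale)
    then have "x \<in> M2"
      using False by (simp add: scaleC_scaleC)
    then have 1: "cinner y x = \<mu> * complex_of_real ((norm x)\<^sup>2)"
      using cinner_proj[OF assms(2), of x y] x(2)
      by (simp add: y_def cinner_diff_left cinner_scaleC_left cinner_self)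
    have "cinner (x - y) y = 0"
      unfolding y_def by (intro cinner_proj proj_in assms)
    then have xy: "cinner x y = complex_of_real ((norm y)\<^sup>2)"
      by (simp add: cinner_diff_left cinner_self)
    then have 2: "cinner y x = complex_of_real ((norm y)\<^sup>2)"
      using cinner_commute[of y x] by simp
    have "0 \<le> (norm (x - y))\<^sup>2"
      by simp
    then have "(norm y)\<^sup>2 \<le> (norm x)\<^sup>2"
      unfolding norm_diff_square xy by (simp flip: of_real_power)
    moreover have "\<mu> = complex_of_real ((norm y)\<^sup>2 / (norm x)\<^sup>2)"
    proof -
      have "\<mu> * complex_of_real ((norm x)\<^sup>2) = complex_of_real ((norm y)\<^sup>2)"
        using 1 2 by (rule trans[OF sym])
      then show ?thesis
        using x(1) by (simp add: nonzero_eq_divide_eq)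
    qed
    ultimately show ?thesis
      using x(1) by (intro image_eqI[where x = "(norm y)\<^sup>2 / (norm x)\<^sup>2"]) auto
  qed auto
qed

end

theory Submission
  imports Defs
begin

text \<open>Write \<open>T = proj M2 \<circ> proj M1\<close> and \<open>S = proj M1 \<circ> proj M2 \<circ> proj M1\<close>. If \<open>h\<close> is a unit vector of \<open>M1\<close> with
  \<open>S h = l *\<^sub>C h\<close> and \<open>0 < l < 1\<close>, then \<open>h\<close> and \<open>proj M2 h\<close> span a plane on which \<open>T\<close> acts as the product of
  two projections onto lines. With respect to the orthonormal basis consisting of \<open>h\<close> and a
  companion vector \<open>k\<close>, a vector with coordinates \<open>(a, b)\<close> has the value
  \<open>l * (cmod a)\<^sup>2 + sqrt (l * (1 - l)) * a * cnj b\<close>, and for coordinates of length one these values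
  fill exactly \<open>elliptic_domain l\<close> (lemma \<open>elliptic_domain_eq\<close>).

  Each such ellipse therefore lies in the numerical range, which is convex
  (\<open>Toeplitz_Hausdorff\<close>). As one of the subspaces is proper, the numerical range also contains \<open>0\<close>, and
  with \<open>0\<close> and \<open>1\<close> it contains the segment \<open>elliptic_domain 1\<close>. So it contains the whole convex hull.

  Conversely, the eigenvectors for nonzero eigenvalues in a basis that diagonalizes \<open>S\<close> give pairwise orthogonal blocks, and \<open>T\<close> is
  determined by its action on them (\<open>proj_proj_series\<close>). So the value of \<open>T\<close> at a unit vector
  is an infinite weighted sum of points of the ellipses, with weights that are squared norms of components
  and hence have total at most one. As no closure is taken in the theorem, a separate
  argument is needed to see that such a sum is a point of the convex hull: in finite dimension every convex
  set contains its infinite convex combinations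
  (\<open>convex_infinite_subconvex_combination\<close>).\<close>

section \<open>Infinite convex combinations in Euclidean spaces\<close>

text \<open>If \<open>0 \<notin> S\<close>, a hyperplane through \<open>0\<close> has \<open>S\<close> on one of its sides. All terms of the
  series lie on that side and sum to \<open>0\<close>, so all of them lie on the hyperplane itself. Since the
  normal vector can be taken in the span of \<open>S\<close>, intersecting \<open>S\<close> with the hyperplane lowers the
  dimension, which makes an induction possible.\<close>

lemma convex_contains_zero_of_has_sum:
  fixes S :: "'b :: euclidean_space set" and t :: "'i \<Rightarrow> real"
  assumes "convex S" "A \<noteq> {}" "\<And>n. n \<in> A \<Longrightarrow> 0 < t n" "\<And>n. n \<in> A \<Longrightarrow> u n \<in> S"
    and "((\<lambda>n. t n *\<^sub>R u n) has_sum 0) A"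
  shows "0 \<in> S"
  using assms
proof (induction "dim S" arbitrary: S rule: less_induct)
  case less
  show ?case
  proof (rule ccontr)
    assume "0 \<notin> S"
    moreover have "S \<noteq> {}"
      using less.prems by blast
    ultimately obtain a where a: "a \<in> span S" "a \<noteq> 0" "\<And>x. x \<in> S \<Longrightarrow> 0 \<le> a \<bullet> x"
      using separating_hyperplane_set_0_inspan[OF less.prems(1)] by metis
    have "((\<lambda>n. a \<bullet> (t n *\<^sub>R u n)) has_sum a \<bullet> 0) A"
      by (rule has_sum_bounded_linear[OF bounded_linear_inner_right less.prems(5)])
    then have sum: "((\<lambda>n. t n * (a \<bullet> u n)) has_sum 0) A"
      by simp
    have orth: "a \<bullet> u n = 0" if "n \<in> A" for n
    proof -
      have "t n * (a \<bullet> u n) = 0"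
        by (rule nonneg_has_sum_le_0D[OF sum _ _ that])
          (use a(3) less.prems(3,4) in \<open>auto intro!: mult_nonneg_nonneg intro: less_imp_le\<close>)
      then show ?thesis
        using less.prems(3)[OF that] by simp
    qed
    define S' where "S' = S \<inter> {x. a \<bullet> x = 0}"
    have "span S' \<subseteq> {x. a \<bullet> x = 0}"
      by (rule span_minimal) (auto simp: S'_def subspace_hyperplane)
    then have "a \<notin> span S'"
      using a(2) by auto
    moreover have "span S' \<subseteq> span S"
      by (rule span_mono) (auto simp: S'_def)
    ultimately have "dim S' < dim S"
      using a(1) by (intro dim_psubset) auto
    moreover have "convex S'"
      unfolding S'_def by (intro convex_Int less.prems(1) convex_hyperplane)
    ultimately have "0 \<in> S'"
      using less.hyps[of S'] less.prems orth by (auto simp: S'_def)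
    then show False
      using \<open>0 \<notin> S\<close> by (simp add: S'_def)
  qed
qed

text \<open>A convex set in finite dimension absorbs infinite convex combinations even when it
  is not closed: translating the barycentre \<open>z / r\<close> to the origin reduces this to the previous
  lemma. Weights with total below one are allowed because \<open>0\<close> takes up the rest.\<close>

lemma convex_infinite_subconvex_combination:
  fixes S :: "'b :: euclidean_space set" and t :: "'i \<Rightarrow> real"
  assumes S: "convex S" "0 \<in> S"
    and t: "\<And>n. n \<in> A \<Longrightarrow> 0 \<le> t n" "(t has_sum r) A" "r \<le> 1"
    and w: "\<And>n. n \<in> A \<Longrightarrow> w n \<in> S"
    and z: "((\<lambda>n. t n *\<^sub>R w n) has_sum z) A"
  shows "z \<in> S"
proof (cases "\<forall>n\<in>A. t n = 0")
  case True
  then have "((\<lambda>n. t n *\<^sub>R w n) has_sum 0) A"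
    by (intro has_sum_0) auto
  then show ?thesis
    using has_sum_unique[OF z] S(2) by blast
next
  case False
  then obtain m where m: "m \<in> A" "t m \<noteq> 0"
    by blast
  define B where "B = {n \<in> A. t n \<noteq> 0}"
  have tB: "(t has_sum r) B" "((\<lambda>n. t n *\<^sub>R w n) has_sum z) B"
    using t(2) z by (auto simp: B_def elim!: has_sum_cong_neutral[THEN iffD1, rotated -1])
  have "t m \<le> r"
    using finite_sum_le_has_sum[OF t(2), of "{m}"] m t(1) by auto
  then have r: "0 < r"
    using t(1)[OF m(1)] m(2) by simp
  have "((\<lambda>n. t n *\<^sub>R - ((1 / r) *\<^sub>R z)) has_sum r *\<^sub>R - ((1 / r) *\<^sub>R z)) B"
    by (rule has_sum_bounded_linear[OF bounded_linear_scaleR_left tB(1)])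
  from has_sum_add[OF tB(2) this]
  have "((\<lambda>n. t n *\<^sub>R (w n - (1 / r) *\<^sub>R z)) has_sum 0) B"
    using r by (simp add: scaleR_diff_right)
  moreover have "convex ((\<lambda>x. x - (1 / r) *\<^sub>R z) ` S)"
    by (rule convex_translation_subtract[OF S(1)])
  ultimately have "0 \<in> (\<lambda>x. x - (1 / r) *\<^sub>R z) ` S"
    using m t(1) w by (intro convex_contains_zero_of_has_sum[where A = B and t = t])
      (force simp: B_def)+
  then have "(1 / r) *\<^sub>R z \<in> S"
    by auto
  then have "r *\<^sub>R ((1 / r) *\<^sub>R z) + (1 - r) *\<^sub>R 0 \<in> S"
    using S r t(3) by (intro convexD) auto
  then show ?thesis
    using r by simp
qed

section \<open>The elliptical domain as a numerical range\<close>

lemma elliptic_domain_iff: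
  assumes l: "0 < l" "l < 1"
  shows "z \<in> elliptic_domain l \<longleftrightarrow> (1 - l) * (Re z - l / 2)\<^sup>2 + (Im z)\<^sup>2 \<le> l * (1 - l) / 4"
proof -
  have "(Re z - l / 2)\<^sup>2 / (l / 4) + (Im z)\<^sup>2 / (l * (1 - l) / 4) =
      ((1 - l) * (Re z - l / 2)\<^sup>2 + (Im z)\<^sup>2) / (l * (1 - l) / 4)"
    using l by (simp add: field_simps)
  then show ?thesis
    using l by (simp add: elliptic_domain_def divide_le_eq)
qed

text \<open>Completing the square in \<open>t\<close>. The circle with centre \<open>l * t\<close> and squared radius
  \<open>l * (1 - l) * (t * (1 - t))\<close> passes through \<open>z\<close> iff the left-hand side vanishes, and on the right
  the first summand is nonnegative for \<open>0 \<le> l\<close> while the second measures by how much \<open>z\<close> violates the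
  inequality of the ellipse. So a point on one of these circles lies in the ellipse, and the \<open>t\<close> that
  kills the square is where to look for a circle through (or around) a given point of the ellipse.\<close>

lemma elliptic_gap:
  fixes z :: complex
  shows "4 * ((cmod (z - of_real (l * t)))\<^sup>2 - l * (1 - l) * (t * (1 - t))) =
    4 * l * (t - (Re z - l / 2 + 1 / 2))\<^sup>2
      + 4 * ((1 - l) * (Re z - l / 2)\<^sup>2 + (Im z)\<^sup>2 - l * (1 - l) / 4)"
  unfolding cmod_power2 by (simp add: power2_eq_square algebra_simps add_divide_distrib diff_divide_distrib)

text \<open>The right-hand side is the numerical range of the matrix with rows \<open>(l, 0)\<close> and
  \<open>(sqrt (l * (1 - l)), 0)\<close>, which represents the product of two projections of the plane onto lines at
  an angle of squared cosine \<open>l\<close>. With \<open>t = (cmod a)\<^sup>2\<close> fixed, it is the circle of the previous lemma,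
  so the numerical range is the union of these circles for \<open>t\<close> in \<open>[0,1]\<close>.
  This description also covers the degenerate cases \<open>l = 0\<close> and \<open>l = 1\<close>.\<close>

lemma elliptic_domain_eq:
  assumes l: "0 \<le> l" "l \<le> 1"
  shows "elliptic_domain l = {of_real (l * (cmod a)\<^sup>2) + of_real (sqrt (l * (1 - l))) * (a * cnj b) | a b.
    (cmod a)\<^sup>2 + (cmod b)\<^sup>2 = 1}" (is "_ = ?R")
proof (cases "l = 0 \<or> l = 1")
  case True
  have "\<exists>a b. t = (cmod a)\<^sup>2 \<and> (cmod a)\<^sup>2 + (cmod b)\<^sup>2 = 1" if "0 \<le> t" "t \<le> 1" for t :: real
    using that by (intro exI[of _ "of_real (sqrt t)"] exI[of _ "of_real (sqrt (1 - t))"]) simp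
  moreover have "(cmod a)\<^sup>2 \<le> 1" if "(cmod a)\<^sup>2 + (cmod b)\<^sup>2 = 1" for a b
    using that zero_le_power2[of "cmod b"] by linarith
  moreover have "\<exists>a b. (cmod a)\<^sup>2 + (cmod b)\<^sup>2 = 1"
    by (intro exI[of _ 1] exI[of _ 0]) simp
  ultimately have "complex_of_real ` {0..1} =
      {complex_of_real ((cmod a)\<^sup>2) | a b. (cmod a)\<^sup>2 + (cmod b)\<^sup>2 = 1}"
    and "{0} = {0 :: complex | a b :: complex. (cmod a)\<^sup>2 + (cmod b)\<^sup>2 = 1}"
    by (fastforce simp: image_iff simp del: of_real_power)+
  then show ?thesis
    using True by (auto simp: elliptic_domain_def simp del: of_real_power)
next
  case False
  then have l: "0 < l" "l < 1"
    using l by auto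
  define s where "s = sqrt (l * (1 - l))"
  have s: "0 < s" "s\<^sup>2 = l * (1 - l)"
    using l by (auto simp: s_def)
  show ?thesis
  proof (intro set_eqI iffI)
    fix z assume "z \<in> elliptic_domain l"
    then have E: "(1 - l) * (Re z - l / 2)\<^sup>2 + (Im z)\<^sup>2 \<le> l * (1 - l) / 4"
      using elliptic_domain_iff l by blast
    define f where "f t = (cmod (z - of_real (l * t)))\<^sup>2 - l * (1 - l) * (t * (1 - t))" for t
    \<comment> \<open>\<open>f t \<le> 0\<close> iff \<open>z\<close> is in the closed disc bounded by the \<open>t\<close>-th circle. The circle for \<open>t = 0\<close>
      is the point \<open>0\<close>, so some \<open>t\<close> between \<open>0\<close> and \<open>T\<close> has \<open>z\<close> on its circle.\<close>
    define T where "T = Re z - l / 2 + 1 / 2"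
    have "(1 - l) * (Re z - l / 2)\<^sup>2 \<le> (1 - l) * (l / 4)"
      using E zero_le_power2[of "Im z"] by (simp only: times_divide_eq_right mult.commute[of l])
    then have "(Re z - l / 2)\<^sup>2 \<le> l / 4"
      using l by (subst (asm) mult_le_cancel_left_pos) auto
    then have "(Re z - l / 2)\<^sup>2 \<le> (1 / 2)\<^sup>2"
      using l by (simp add: power_divide)
    then have "\<bar>Re z - l / 2\<bar> \<le> 1 / 2"
      by (metis abs_le_square_iff abs_of_nonneg zero_le_divide_1_iff zero_le_numeral)
    then have T: "0 \<le> T" "T \<le> 1"
      unfolding T_def by linarith+
    have "f T \<le> 0"
      using elliptic_gap[of z l T] E by (simp add: f_def T_def)
    moreover have "0 \<le> f 0"
      by (simp add: f_def)
    moreover have "continuous_on {0..T} f"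
      unfolding f_def by (intro continuous_intros)
    ultimately obtain t where t: "0 \<le> t" "t \<le> T" "f t = 0"
      using IVT2'[of f T 0 0] T by auto
    then have t1: "t \<le> 1" and ft: "(cmod (z - of_real (l * t)))\<^sup>2 = s\<^sup>2 * (t * (1 - t))"
      using T by (auto simp: f_def s)
    show "z \<in> ?R"
    proof (cases "t = 0")
      case True
      then have "z = 0"
        using ft by simp
      then show ?thesis
        by (intro CollectI exI[of _ 0] exI[of _ 1]) simp
    next
      case False
      \<comment> \<open>The phase of \<open>z - l * t\<close> goes entirely into \<open>b\<close>.\<close>
      define a where "a = complex_of_real (sqrt t)"
      define b where "b = cnj ((z - of_real (l * t)) / (of_real s * a))"
      have a: "(cmod a)\<^sup>2 = t" "a \<noteq> 0"
        using t False by (auto simp: a_def)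
      have "cmod b = cmod (z - of_real (l * t)) / cmod (of_real s * a)"
        unfolding b_def complex_mod_cnj norm_divide ..
      then have "(cmod b)\<^sup>2 = (s\<^sup>2 * (t * (1 - t))) / (s\<^sup>2 * t)"
        using a by (simp only: power_divide ft norm_mult power_mult_distrib norm_of_real power2_abs)
      then have "(cmod b)\<^sup>2 = 1 - t"
        using s(1) False by simp
      then show ?thesis
        using a s(1) unfolding s_def[symmetric]
        by (intro CollectI exI[of _ a] exI[of _ b]) (simp add: b_def)
    qed
  next
    fix z assume "z \<in> ?R"
    then obtain a b where z: "z = of_real (l * (cmod a)\<^sup>2) + of_real s * (a * cnj b)"
      and ab: "(cmod a)\<^sup>2 + (cmod b)\<^sup>2 = 1"
      by (auto simp: s_def)
    have "(cmod b)\<^sup>2 = 1 - (cmod a)\<^sup>2"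
      using ab by simp
    then have "(cmod (z - of_real (l * (cmod a)\<^sup>2)))\<^sup>2 = l * (1 - l) * ((cmod a)\<^sup>2 * (1 - (cmod a)\<^sup>2))"
      using s by (simp add: z norm_mult power_mult_distrib)
    then show "z \<in> elliptic_domain l"
      using elliptic_gap[of z l "(cmod a)\<^sup>2"] l
      by (simp add: elliptic_domain_iff) (smt (verit) mult_nonneg_nonneg zero_le_power2)
  qed
qed

text \<open>The homogeneous form, for a vector \<open>(a, b)\<close> of arbitrary length.\<close>

lemma scaled_elliptic_domain:
  assumes l: "0 \<le> l" "l \<le> 1"
  shows "\<exists>w\<in>elliptic_domain l. of_real (l * (cmod a)\<^sup>2) + of_real (sqrt (l * (1 - l))) * (a * cnj b) =
    ((cmod a)\<^sup>2 + (cmod b)\<^sup>2) *\<^sub>R w"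
proof (cases "a = 0 \<and> b = 0")
  case True
  moreover have "of_real l \<in> elliptic_domain l"
    unfolding elliptic_domain_eq[OF l] by (intro CollectI exI[of _ 1] exI[of _ 0]) simp
  ultimately show ?thesis
    by auto
next
  case False
  define r where "r = (cmod a)\<^sup>2 + (cmod b)\<^sup>2"
  have r: "0 < r"
    using False by (auto simp: r_def add_pos_nonneg add_nonneg_pos)
  define c where "c = complex_of_real (1 / sqrt r)"
  have c: "(cmod c)\<^sup>2 = 1 / r" "c * cnj c = of_real (1 / r)"
    using r by (simp_all add: c_def power_divide norm_divide flip: of_real_mult of_real_divide)
  define w where "w = of_real (l * (cmod (c * a))\<^sup>2) + of_real (sqrt (l * (1 - l))) * ((c * a) * cnj (c * b))"
  have "(cmod (c * a))\<^sup>2 + (cmod (c * b))\<^sup>2 = 1"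
    using False by (simp add: norm_mult power_mult_distrib c(1) r_def flip: add_divide_distrib)
  then have "w \<in> elliptic_domain l"
    unfolding elliptic_domain_eq[OF l] w_def by blast
  moreover have "(c * a) * cnj (c * b) = of_real (1 / r) * (a * cnj b)"
    unfolding c(2)[symmetric] by simp
  then have "r *\<^sub>R w = of_real (l * (cmod a)\<^sup>2) + of_real (sqrt (l * (1 - l))) * (a * cnj b)"
    using r by (simp add: w_def norm_mult power_mult_distrib c(1) scaleR_conv_of_real distrib_left)
  ultimately show ?thesis
    unfolding r_def by metis
qed

section \<open>The inner product\<close>

lemma cinner_sum_left: "cinner (\<Sum>n\<in>F. f n) y = (\<Sum>n\<in>F. cinner (f n) y)"
  by (induction F rule: infinite_finite_induct) (auto simp: cinner_add_left)

lemma cinner_sum_right: "cinner y (\<Sum>n\<in>F. f n) = (\<Sum>n\<in>F. cinner y (f n))"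
  by (induction F rule: infinite_finite_induct) (auto simp: cinner_add_right)

lemma cauchy_schwarz: "cmod (cinner x y) \<le> norm x * norm y"
proof (cases "y = 0")
  case False
  define a where "a = cinner x y / of_real ((norm y)\<^sup>2)"
  have a: "cinner x y = a * of_real ((norm y)\<^sup>2)"
    using False by (simp add: a_def)
  have "cinner x (a *\<^sub>C y) = of_real ((cmod a * norm y)\<^sup>2)"
    unfolding cinner_scaleC_right a power_mult_distrib of_real_mult complex_norm_square
    by (simp only: ac_simps)
  then have "(norm (x - a *\<^sub>C y))\<^sup>2 = (norm x)\<^sup>2 - (cmod a * norm y)\<^sup>2"
    unfolding norm_diff_square norm_scaleC by (simp del: of_real_power)
  then have "(cmod a * norm y)\<^sup>2 \<le> (norm x)\<^sup>2"
    using zero_le_power2[of "norm (x - a *\<^sub>C y)"] by linarith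
  then have "cmod a * norm y \<le> norm x"
    by (rule power2_le_imp_le) simp
  then have "(cmod a * norm y) * norm y \<le> norm x * norm y"
    by (rule mult_right_mono) simp
  then show ?thesis
    by (simp add: a norm_mult power2_eq_square)
qed simp

lemma bounded_linear_cinner_left: "bounded_linear (\<lambda>x. cinner x y)"
  by (rule bounded_linear_intro[where K = "norm y"])
    (auto simp: cinner_add_left scaleR_eq_scaleC cinner_scaleC_left cauchy_schwarz scaleC_complex_def)

text \<open>The form of Bessel's equality for the components \<open>p n\<close> of \<open>x\<close> in pairwise orthogonal
  subspaces: the last assumption says that \<open>x - p n\<close> is orthogonal to \<open>p n\<close>. It thus serves
  for one-dimensional and for two-dimensional blocks alike.\<close>

lemma norm_diff_orthogonal_sum:
  fixes p :: "'i \<Rightarrow> 'a :: complex_hilbert_space"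
  assumes fin: "finite F"
    and orth: "\<And>m n. m \<in> F \<Longrightarrow> n \<in> F \<Longrightarrow> m \<noteq> n \<Longrightarrow> cinner (p m) (p n) = 0"
    and comp: "\<And>n. n \<in> F \<Longrightarrow> cinner x (p n) = of_real ((norm (p n))\<^sup>2)"
  shows "(norm (x - (\<Sum>n\<in>F. p n)))\<^sup>2 = (norm x)\<^sup>2 - (\<Sum>n\<in>F. (norm (p n))\<^sup>2)"
proof -
  have "cinner (\<Sum>n\<in>F. p n) (\<Sum>n\<in>F. p n) = (\<Sum>m\<in>F. \<Sum>n\<in>F. cinner (p m) (p n))"
    unfolding cinner_sum_left cinner_sum_right by (rule sum.swap)
  also have "\<dots> = (\<Sum>m\<in>F. \<Sum>n\<in>F. if m = n then of_real ((norm (p n))\<^sup>2) else 0)"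
    by (intro sum.cong refl) (use orth in \<open>auto simp: cinner_self\<close>)
  also have "\<dots> = of_real (\<Sum>n\<in>F. (norm (p n))\<^sup>2)"
    using fin by simp
  finally have "(norm (\<Sum>n\<in>F. p n))\<^sup>2 = (\<Sum>n\<in>F. (norm (p n))\<^sup>2)"
    unfolding cinner_self of_real_eq_iff .
  moreover have "cinner x (\<Sum>n\<in>F. p n) = of_real (\<Sum>n\<in>F. (norm (p n))\<^sup>2)"
    unfolding cinner_sum_right of_real_sum by (intro sum.cong refl comp)
  ultimately show ?thesis
    unfolding norm_diff_square by (simp del: of_real_sum)
qed

section \<open>Convexity of the numerical range\<close>

abbreviation clinear :: "('a :: complex_hilbert_space \<Rightarrow> 'a) \<Rightarrow> bool"
  where "clinear \<equiv> Vector_Spaces.linear scaleC scaleC"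

lemma numerical_rangeI:
  assumes T: "clinear T" and z: "z \<noteq> 0" and w: "cinner (T z) z = w * of_real ((norm z)\<^sup>2)"
  shows "w \<in> numerical_range T"
proof -
  define c where "c = complex_of_real (1 / norm z)"
  have "T (c *\<^sub>C z) = c *\<^sub>C T z"
    using T by (simp add: Vector_Spaces.linear_iff)
  then have "cinner (T (c *\<^sub>C z)) (c *\<^sub>C z) = w"
    using z by (simp add: cinner_scaleC_left cinner_scaleC_right w c_def power2_eq_square)
  moreover have "norm (c *\<^sub>C z) = 1"
    using z by (simp add: norm_scaleC c_def norm_divide)
  ultimately show ?thesis
    unfolding numerical_range_def by blast
qed

text \<open>The form \<open>B\<close> is the form of \<open>T\<close> after the affine change of scale that sends \<open>\<alpha>\<close> to \<open>1\<close>
  and \<open>\<beta>\<close> to \<open>0\<close>. Multiplying \<open>x\<close> by a suitable phase makes \<open>B\<close> real on the segment from \<open>y\<close> to \<open>x\<close>,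
  and the intermediate value theorem on this segment yields every convex combination.\<close>

theorem Toeplitz_Hausdorff:
  assumes T: "clinear T"
  shows "convex (numerical_range T)"
proof (rule convexI)
  fix \<alpha> \<beta> :: complex and u v :: real
  assume \<alpha>: "\<alpha> \<in> numerical_range T" and \<beta>: "\<beta> \<in> numerical_range T"
    and uv: "0 \<le> u" "0 \<le> v" "u + v = 1"
  obtain x y where x: "cinner (T x) x = \<alpha>" "norm x = 1" and y: "cinner (T y) y = \<beta>" "norm y = 1"
    using \<alpha> \<beta> unfolding numerical_range_def by auto
  show "u *\<^sub>R \<alpha> + v *\<^sub>R \<beta> \<in> numerical_range T"
  proof (cases "\<alpha> = \<beta>")
    case True
    then show ?thesis
      using \<alpha> uv by (simp flip: scaleR_add_left)
  next
    case False
    define B where "B p q = (cinner (T p) q - \<beta> * cinner p q) / (\<alpha> - \<beta>)" for p q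
    have B_add: "B (p + p') q = B p q + B p' q" "B q (p + p') = B q p + B q p'" for p p' q
      using T by (simp_all add: B_def Vector_Spaces.linear_iff cinner_add_left cinner_add_right
          distrib_left algebra_simps flip: add_divide_distrib)
    have B_scale: "B (c *\<^sub>C p) q = c * B p q" "B p (c *\<^sub>C q) = cnj c * B p q" for c p q
      using T by (simp_all add: B_def Vector_Spaces.linear_iff cinner_scaleC_left cinner_scaleC_right
          algebra_simps)
    have B_diag: "B x x = 1" "B y y = 0"
      using False by (simp_all add: B_def x y cinner_self)
    \<comment> \<open>The phase \<open>\<theta>\<close> is chosen so that \<open>\<theta> * B x y + cnj \<theta> * B y x\<close> is real; its imaginary part
      is that of \<open>\<theta> * e\<close>.\<close>
    define e where "e = B x y - cnj (B y x)"
    define \<theta> where "\<theta> = (if e = 0 then 1 else cnj e / of_real (cmod e))"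
    have \<theta>: "cmod \<theta> = 1" "\<theta> * cnj \<theta> = 1"
      using complex_norm_square[of \<theta>] by (auto simp: \<theta>_def norm_divide)
    have "\<theta> * e = of_real (cmod e)"
      by (simp add: \<theta>_def complex_norm_square[symmetric] power2_eq_square mult.commute[of "cnj e"])
    define x' where "x' = \<theta> *\<^sub>C x"
    have x': "B x' x' = 1" "norm x' = 1"
      using \<theta> by (simp_all add: x'_def B_scale B_diag norm_scaleC x mult.commute)
    define \<gamma> where "\<gamma> = Re (B x' y + B y x')"
    have "Im (B x' y + B y x') = Im (\<theta> * e)"
      by (simp add: x'_def B_scale e_def algebra_simps)
    then have \<gamma>: "B x' y + B y x' = of_real \<gamma>"
      by (simp add: \<gamma>_def complex_eq_iff \<open>\<theta> * e = _\<close>)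
    define z where "z t = of_real t *\<^sub>C x' + of_real (1 - t) *\<^sub>C y" for t
    have Bz: "B (z t) (z t) = of_real (t\<^sup>2 + t * (1 - t) * \<gamma>)" for t
    proof -
      have "B (of_real t *\<^sub>C x' + of_real q *\<^sub>C y) (of_real t *\<^sub>C x' + of_real q *\<^sub>C y) =
          of_real (t\<^sup>2) + of_real (t * q) * (B x' y + B y x')" for q
        by (simp add: B_add B_scale B_diag x' power2_eq_square algebra_simps)
      from this[of "1 - t"] show ?thesis
        unfolding \<gamma> z_def by simp
    qed
    define \<phi> where "\<phi> t = t\<^sup>2 + t * (1 - t) * \<gamma> - u * (norm (z t))\<^sup>2" for t
    have "continuous_on {0..1} z"
      unfolding z_def scaleR_eq_scaleC[symmetric] by (intro continuous_intros)
    then have "continuous_on {0..1} \<phi>"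
      unfolding \<phi>_def by (intro continuous_intros)
    moreover have "\<phi> 0 \<le> 0" "0 \<le> \<phi> 1"
      using uv by (simp_all add: \<phi>_def z_def x' y scaleC_one)
    ultimately obtain t where t: "0 \<le> t" "t \<le> 1" "\<phi> t = 0"
      using IVT'[of \<phi> 0 0 1] by auto
    have "z t \<noteq> 0"
    proof
      assume "z t = 0"
      then have zt: "of_real t *\<^sub>C x' = - (of_real (1 - t) *\<^sub>C y)"
        by (simp add: z_def add_eq_0_iff2)
      then have "norm (of_real t *\<^sub>C x') = norm (of_real (1 - t) *\<^sub>C y)"
        by simp
      \<comment> \<open>Both coefficients are \<open>1 / 2\<close>, so \<open>x'\<close> would be \<open>- y\<close>, against \<open>B x' x' = 1\<close> and \<open>B y y = 0\<close>.\<close>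
      then have th: "t = 1 - t"
        using t by (simp add: norm_scaleC x' y flip: of_real_diff)
      have "B (- p) (- p) = B p p" for p
        using B_scale(1)[of "-1" p "- p"] B_scale(2)[of p "-1" p] by simp
      then have "B (of_real t *\<^sub>C x') (of_real t *\<^sub>C x') =
          B (of_real (1 - t) *\<^sub>C y) (of_real (1 - t) *\<^sub>C y)"
        unfolding zt .
      then have "cnj (of_real t) * (of_real t * B x' x') = cnj (of_real (1 - t)) * (of_real (1 - t) * B y y)"
        unfolding B_scale .
      then show False
        using th by (simp add: x' B_diag)
    qed
    moreover have "cinner (T (z t)) (z t) = (u *\<^sub>R \<alpha> + v *\<^sub>R \<beta>) * of_real ((norm (z t))\<^sup>2)"
    proof -
      define N where "N = complex_of_real ((norm (z t))\<^sup>2)"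
      have "t\<^sup>2 + t * (1 - t) * \<gamma> = u * (norm (z t))\<^sup>2"
        using t(3) by (simp add: \<phi>_def)
      then have "B (z t) (z t) = of_real u * N"
        unfolding Bz N_def by (simp only: of_real_mult)
      then have "cinner (T (z t)) (z t) - \<beta> * N = of_real u * N * (\<alpha> - \<beta>)"
        using False unfolding B_def N_def cinner_self by (subst (asm) divide_eq_eq) simp
      then have "cinner (T (z t)) (z t) = of_real u * N * (\<alpha> - \<beta>) + \<beta> * N"
        by (simp only: diff_eq_eq)
      also have "\<dots> = (of_real u * \<alpha> + of_real (1 - u) * \<beta>) * N"
        by (simp add: algebra_simps)
      also have "1 - u = v"
        using uv by simp
      finally show ?thesis
        by (simp add: scaleR_conv_of_real N_def)
    qed
    ultimately show ?thesis
      by (rule numerical_rangeI[OF T])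
  qed
qed

section \<open>Orthogonal projections\<close>

lemma proj_eqI:
  assumes "closed_csubspace M" "y \<in> M" "\<And>z. z \<in> M \<Longrightarrow> cinner (x - y) z = 0"
  shows "proj M x = y"
  using ex1_proj[OF assms(1), of x] proj_in[OF assms(1)] cinner_proj[OF assms(1)] assms(2,3) by blast

lemma proj_id: "closed_csubspace M \<Longrightarrow> x \<in> M \<Longrightarrow> proj M x = x"
  by (rule proj_eqI) auto

lemma clinear_proj:
  assumes M: "closed_csubspace M"
  shows "clinear (proj M)"
proof -
  have sub: "complex_vector.subspace M"
    using M by (simp add: closed_csubspace_def)
  have "proj M (x + y) = proj M x + proj M y" for x y
    by (rule proj_eqI[OF M complex_vector.subspace_add[OF sub proj_in[OF M] proj_in[OF M]]])
      (use cinner_proj[OF M] in \<open>simp add: add_diff_add cinner_add_left\<close>)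
  moreover have "proj M (c *\<^sub>C x) = c *\<^sub>C proj M x" for c x
    by (rule proj_eqI[OF M complex_vector.subspace_scale[OF sub proj_in[OF M]]])
      (use cinner_proj[OF M] in \<open>simp add: cinner_scaleC_left
          flip: complex_vector.scale_right_diff_distrib\<close>)
  ultimately show ?thesis
    by (simp add: Vector_Spaces.linear_iff complex_vector.vector_space_axioms)
qed

lemmas proj_add = Vector_Spaces.linear_iff[THEN iffD1, OF clinear_proj, THEN conjunct2,
    THEN conjunct2, THEN conjunct1, rule_format]
lemmas proj_scaleC = Vector_Spaces.linear_iff[THEN iffD1, OF clinear_proj, THEN conjunct2,
    THEN conjunct2, THEN conjunct2, rule_format]

lemma cinner_proj_left: "closed_csubspace M \<Longrightarrow> cinner (proj M x) y = cinner (proj M x) (proj M y)"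
  using cinner_proj[of M "proj M x" y] proj_in[of M x] cinner_commute[of "proj M x"]
  by (simp add: cinner_diff_left)

lemma cinner_proj_right: "closed_csubspace M \<Longrightarrow> cinner x (proj M y) = cinner (proj M x) (proj M y)"
  using cinner_proj[of M "proj M y" x] proj_in[of M y] by (simp add: cinner_diff_left)

lemma cinner_proj_adjoint: "closed_csubspace M \<Longrightarrow> cinner (proj M x) y = cinner x (proj M y)"
  using cinner_proj_left cinner_proj_right by metis

lemma proj_eq_zeroI: "closed_csubspace M \<Longrightarrow> (\<And>z. z \<in> M \<Longrightarrow> cinner x z = 0) \<Longrightarrow> proj M x = 0"
  by (rule proj_eqI) (auto simp: closed_csubspace_def complex_vector.subspace_0)

lemma ex_proj_zero:
  assumes M: "closed_csubspace M" "M \<noteq> UNIV"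
  obtains x where "x \<noteq> 0" "proj M x = 0"
proof -
  obtain y where "y \<notin> M"
    using M(2) by blast
  then have "y - proj M y \<noteq> 0"
    using proj_in[OF M(1), of y] by auto
  moreover have "proj M (y - proj M y) = 0"
    using M(1) cinner_proj by (intro proj_eq_zeroI) auto
  ultimately show thesis
    by (rule that)
qed

section \<open>Eigenvectors of two projections\<close>

text \<open>For a unit vector \<open>h\<close> of \<open>M1\<close> with \<open>proj M1 (proj M h) = l *\<^sub>C h\<close> this is the normalized component
  of \<open>proj M h\<close> orthogonal to \<open>h\<close>, the vector that completes \<open>h\<close> to an orthonormal basis of the plane
  spanned by \<open>h\<close> and \<open>proj M h\<close>. If \<open>l\<close> is \<open>0\<close> or \<open>1\<close>, the plane collapses and the division by zero makes
  the vector \<open>0\<close>.\<close>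

definition companion :: "'a :: complex_hilbert_space set \<Rightarrow> real \<Rightarrow> 'a \<Rightarrow> 'a"
  where "companion M l h = of_real (1 / sqrt (l * (1 - l))) *\<^sub>C (proj M h - of_real l *\<^sub>C h)"

context
  fixes M1 M2 :: "'a :: complex_hilbert_space set"
  assumes M1: "closed_csubspace M1" and M2: "closed_csubspace M2"
begin

lemma cinner_proj_eigenvector:
  assumes "proj M1 (proj M2 h) = of_real l *\<^sub>C h" "h' \<in> M1"
  shows "cinner (proj M2 h) h' = of_real l * cinner h h'"
    and "cinner h (proj M2 h') = of_real l * cinner h h'"
    and "cinner (proj M2 h) (proj M2 h') = of_real l * cinner h h'"
proof -
  show *: "cinner (proj M2 h) h' = of_real l * cinner h h'"
    using cinner_proj_adjoint[OF M1, of "proj M2 h" h'] assms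
    by (simp add: proj_id[OF M1] cinner_scaleC_left)
  then show "cinner h (proj M2 h') = of_real l * cinner h h'"
    by (simp add: cinner_proj_adjoint[OF M2])
  show "cinner (proj M2 h) (proj M2 h') = of_real l * cinner h h'"
    using * by (simp add: cinner_proj_left[OF M2, symmetric])
qed

text \<open>Orthogonal eigenvectors have orthogonal planes.\<close>

lemma companion_orthogonal:
  assumes h: "proj M1 (proj M2 h) = of_real l *\<^sub>C h" "h \<in> M1"
    and h': "proj M1 (proj M2 h') = of_real l' *\<^sub>C h'" "h' \<in> M1"
    and orth: "cinner h h' = 0"
  shows "cinner h (companion M2 l' h') = 0" "cinner (companion M2 l h) h' = 0"
    "cinner (companion M2 l h) (companion M2 l' h') = 0"
  unfolding companion_def
  by (simp_all add: cinner_scaleC_left cinner_scaleC_right cinner_diff_left cinner_diff_right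
      cinner_proj_eigenvector[OF h(1)] h'(2) orth)

context
  fixes l :: real and h :: 'a
  assumes h: "h \<in> M1" "norm h = 1" and eigen: "proj M1 (proj M2 h) = of_real l *\<^sub>C h"
begin

text \<open>The eigenvalue is the squared cosine of the angle between \<open>h\<close> and \<open>M2\<close>.\<close>

lemma norm_proj_eigenvector: "(norm (proj M2 h))\<^sup>2 = l"
proof -
  have "complex_of_real ((norm (proj M2 h))\<^sup>2) = of_real l"
    using cinner_proj_eigenvector(3)[OF eigen h(1)] by (simp add: cinner_self h(2))
  then show ?thesis
    unfolding of_real_eq_iff .
qed

lemma norm_diff_proj_eigenvector: "(norm (proj M2 h - of_real l *\<^sub>C h))\<^sup>2 = l * (1 - l)"
proof -
  have "cinner (proj M2 h) (of_real l *\<^sub>C h) = of_real (l\<^sup>2)"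
    using cinner_proj_eigenvector(1)[OF eigen h(1)]
    by (simp add: cinner_scaleC_right cinner_self h(2) power2_eq_square)
  then show ?thesis
    unfolding norm_diff_square norm_proj_eigenvector norm_scaleC
    by (simp add: h(2) algebra_simps power2_eq_square del: of_real_power)
qed

lemma eigenvalue_range: "0 \<le> l" "l \<le> 1"
proof -
  show "0 \<le> l"
    using zero_le_power2[of "norm (proj M2 h)"] by (simp only: norm_proj_eigenvector)
  have "cinner h (proj M2 h) = of_real l"
    using cinner_proj_eigenvector(2)[OF eigen h(1)] by (simp add: cinner_self h(2))
  then have "(norm (h - proj M2 h))\<^sup>2 = 1 - l"
    unfolding norm_diff_square norm_proj_eigenvector by (simp add: h(2))
  then show "l \<le> 1"
    using zero_le_power2[of "norm (h - proj M2 h)"] by linarith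
qed

lemma proj_eigenvector_eq:
  "proj M2 h = of_real l *\<^sub>C h + of_real (sqrt (l * (1 - l))) *\<^sub>C companion M2 l h"
proof (cases "l * (1 - l) = 0")
  case True
  have "(norm (proj M2 h - of_real l *\<^sub>C h))\<^sup>2 = 0"
    unfolding norm_diff_proj_eigenvector by (rule True)
  then have "proj M2 h = of_real l *\<^sub>C h"
    by simp
  then show ?thesis
    unfolding True by simp
next
  case False
  then have "sqrt (l * (1 - l)) \<noteq> 0"
    by simp
  then show ?thesis
    unfolding companion_def scaleC_scaleC of_real_mult[symmetric] by (simp add: scaleC_one)
qed

lemma cinner_companion: "cinner h (companion M2 l h) = 0" "cinner (companion M2 l h) h = 0"
  unfolding companion_def
  by (simp_all add: cinner_scaleC_left cinner_scaleC_right cinner_diff_left cinner_diff_right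
      cinner_proj_eigenvector[OF eigen h(1)] cinner_self h(2))

lemma proj_companion: "proj M1 (companion M2 l h) = 0"
proof (rule proj_eq_zeroI[OF M1])
  fix z assume "z \<in> M1"
  then show "cinner (companion M2 l h) z = 0"
    unfolding companion_def
    by (simp add: cinner_scaleC_left cinner_diff_left cinner_proj_eigenvector(1)[OF eigen])
qed

lemma norm_companion: "norm (companion M2 l h) = (if l = 0 \<or> l = 1 then 0 else 1)"
proof -
  have "sqrt (l * (1 - l)) = norm (proj M2 h - of_real l *\<^sub>C h)"
    by (simp flip: norm_diff_proj_eigenvector)
  then have "norm (companion M2 l h) = sqrt (l * (1 - l)) / sqrt (l * (1 - l))"
    using eigenvalue_range by (simp add: companion_def norm_scaleC norm_divide)
  then show ?thesis
    by auto
qed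

lemma cinner_block:
  assumes "proj M1 x = a *\<^sub>C h" "cinner x h = a" "cinner x (companion M2 l h) = b"
  shows "cinner (proj M2 (proj M1 x)) x =
    of_real (l * (cmod a)\<^sup>2) + of_real (sqrt (l * (1 - l))) * (a * cnj b)"
  using assms(2,3) cinner_commute[of h x] cinner_commute[of "companion M2 l h" x]
  by (simp add: assms(1) proj_scaleC[OF M2] proj_eigenvector_eq cinner_scaleC_left cinner_add_left
      distrib_left algebra_simps complex_norm_square del: of_real_power)

text \<open>On the plane spanned by \<open>h\<close> and its companion, \<open>proj M2 \<circ> proj M1\<close> acts as the matrix
  whose numerical range is the ellipse.\<close>

lemma elliptic_domain_subset_block:
  assumes l: "0 < l" "l < 1"
  shows "elliptic_domain l \<subseteq> numerical_range (proj M2 \<circ> proj M1)"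
proof
  fix w assume "w \<in> elliptic_domain l"
  then obtain a b where w: "w = of_real (l * (cmod a)\<^sup>2) + of_real (sqrt (l * (1 - l))) * (a * cnj b)"
    and ab: "(cmod a)\<^sup>2 + (cmod b)\<^sup>2 = 1"
    using l by (auto simp: elliptic_domain_eq)
  define k where "k = companion M2 l h"
  define x where "x = a *\<^sub>C h + b *\<^sub>C k"
  have k: "norm k = 1" "cinner h k = 0" "cinner k h = 0" "proj M1 k = 0"
    using norm_companion cinner_companion proj_companion l by (simp_all add: k_def)
  have "(norm x)\<^sup>2 = 1"
    unfolding x_def norm_add_square norm_scaleC
    using ab by (simp add: cinner_scaleC_left cinner_scaleC_right k h(2))
  then have "norm x = 1"
    by (simp add: power2_eq_1_iff) (smt (verit) norm_ge_zero)
  moreover have "cinner (proj M2 (proj M1 x)) x = w"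
    unfolding w
    by (rule cinner_block) (simp_all add: x_def proj_add[OF M1] proj_scaleC[OF M1] k proj_id[OF M1]
        h cinner_add_left cinner_scaleC_left cinner_self flip: k_def)
  ultimately show "w \<in> numerical_range (proj M2 \<circ> proj M1)"
    by (auto simp: numerical_range_def)
qed

end

text \<open>This is where properness enters: the product of two identity operators has at most \<open>1\<close>
  in its numerical range, whereas \<open>elliptic_domain 1\<close> is a segment. Vectors that one of the projections
  annihilates have the value \<open>0\<close>.\<close>

lemma zero_in_numerical_range:
  assumes "M1 \<noteq> UNIV \<or> M2 \<noteq> UNIV"
  shows "0 \<in> numerical_range (proj M2 \<circ> proj M1)"
proof -
  have lin: "clinear (proj M2 \<circ> proj M1)"
    by (rule Vector_Spaces.linear_compose[OF clinear_proj clinear_proj]) (rule M1 M2)+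
  obtain x where "x \<noteq> 0" "proj M1 x = 0 \<or> proj M2 x = 0"
    using assms ex_proj_zero[OF M1] ex_proj_zero[OF M2] by metis
  moreover from this(2) have "cinner (proj M2 (proj M1 x)) x = 0"
    using cinner_proj_adjoint[OF M2, of "proj M1 x" x] cinner_proj_adjoint[OF M2, of 0 x]
    by (auto simp: cinner_proj_left[OF M2, of _ x])
  ultimately show ?thesis
    by (intro numerical_rangeI[OF lin]) auto
qed

lemma zero_in_point_spectrum:
  assumes "M1 \<noteq> UNIV \<or> M2 \<noteq> UNIV"
  shows "0 \<in> point_spectrum (proj M2 \<circ> proj M1)"
proof -
  have "proj M2 0 = 0"
    by (rule proj_eq_zeroI[OF M2]) simp
  moreover obtain x where "x \<noteq> 0" "proj M1 x = 0 \<or> (M1 = UNIV \<and> proj M2 x = 0)"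
    using assms ex_proj_zero[OF M1] ex_proj_zero[OF M2] by metis
  ultimately show ?thesis
    using proj_id[OF M1, of x] by (auto simp: point_spectrum_def intro!: exI[of _ x])
qed

text \<open>An eigenvector \<open>x\<close> of \<open>proj M2 \<circ> proj M1\<close> for \<open>l\<close> with \<open>0 < l < 1\<close> yields the eigenvector \<open>proj M1 x\<close>
  of \<open>proj M1 \<circ> proj M2\<close> in \<open>M1\<close>, hence a plane as above. For \<open>l = 1\<close> there is no such plane:
  there the segment comes from the values \<open>1\<close> at \<open>x\<close> and \<open>0\<close>, joined by convexity.\<close>

lemma elliptic_domain_subset_numerical_range:
  assumes proper: "M1 \<noteq> UNIV \<or> M2 \<noteq> UNIV"
    and l: "complex_of_real l \<in> point_spectrum (proj M2 \<circ> proj M1)"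
  shows "elliptic_domain l \<subseteq> numerical_range (proj M2 \<circ> proj M1)" (is "_ \<subseteq> ?W")
proof -
  have lin: "clinear (proj M2 \<circ> proj M1)"
    by (rule Vector_Spaces.linear_compose[OF clinear_proj clinear_proj]) (rule M1 M2)+
  note W0 = zero_in_numerical_range[OF proper]
  have range: "0 \<le> l" "l \<le> 1"
    using point_spectrum_proj_proj[OF M1 M2] l by auto
  obtain x where x: "x \<noteq> 0" "proj M2 (proj M1 x) = of_real l *\<^sub>C x"
    using l by (auto simp: point_spectrum_def)
  consider "l = 0" | "l = 1" | "0 < l" "l < 1"
    using range by linarith
  then show ?thesis
  proof cases
    case 1
    then show ?thesis
      using W0 by (simp add: elliptic_domain_def)
  next
    case 2
    have W1: "1 \<in> ?W"
      using 2 x by (intro numerical_rangeI[OF lin x(1)]) (simp add: scaleC_one cinner_self)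
    have "complex_of_real t \<in> ?W" if "0 \<le> t" "t \<le> 1" for t
      using convexD[OF Toeplitz_Hausdorff[OF lin] W1 W0, of t "1 - t"] that
      by (simp add: scaleR_conv_of_real)
    then show ?thesis
      using 2 by (auto simp: elliptic_domain_def)
  next
    case 3
    define y where "y = proj M1 x"
    have "y \<noteq> 0"
    proof
      assume "y = 0"
      then have "of_real l *\<^sub>C x = 0"
        using x(2) proj_eq_zeroI[OF M2, of 0] by (simp add: y_def)
      then show False
        using x(1) 3 by simp
    qed
    define c where "c = complex_of_real (1 / norm y)"
    show ?thesis
    proof (rule elliptic_domain_subset_block[OF _ _ _ 3])
      show "c *\<^sub>C y \<in> M1"
        using M1 proj_in[OF M1, of x]
        by (auto simp: y_def closed_csubspace_def complex_vector.subspace_scale)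
      show "norm (c *\<^sub>C y) = 1"
        using \<open>y \<noteq> 0\<close> by (simp add: norm_scaleC c_def norm_divide)
      show "proj M1 (proj M2 (c *\<^sub>C y)) = of_real l *\<^sub>C c *\<^sub>C y"
        by (simp add: proj_scaleC[OF M1] proj_scaleC[OF M2] y_def x(2) scaleC_scaleC mult.commute)
    qed
  qed
qed

section \<open>Series expansion along a diagonalizing basis\<close>

text \<open>Convergence of the expansion of \<open>T = proj M2 \<circ> proj M1\<close> follows from that of
  \<open>S = proj M1 \<circ> proj M2 \<circ> proj M1\<close>, because \<open>(norm (T y))\<^sup>2 = cinner (S y) y\<close> which is at most
  \<open>norm (S y) * norm y\<close>, and the remainders \<open>y\<close> of the Fourier series of \<open>x\<close> stay bounded in norm.\<close>

lemma proj_proj_series: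
  assumes orth: "\<And>m n. m \<in> I \<Longrightarrow> n \<in> I \<Longrightarrow> cinner (h m) (h n) = (if m = n then 1 else 0)"
    and eigen: "\<And>n. n \<in> I \<Longrightarrow> (proj M1 \<circ> proj M2 \<circ> proj M1) (h n) = c n *\<^sub>C h n"
    and diag: "((\<lambda>n. (c n * cinner x (h n)) *\<^sub>C h n) has_sum (proj M1 \<circ> proj M2 \<circ> proj M1) x) I"
  shows "((\<lambda>n. cinner x (h n) *\<^sub>C (proj M2 \<circ> proj M1) (h n)) has_sum (proj M2 \<circ> proj M1) x) I"
proof -
  define T where "T = proj M2 \<circ> proj M1"
  define S where "S = proj M1 \<circ> proj M2 \<circ> proj M1"
  interpret T: Vector_Spaces.linear scaleC scaleC T
    unfolding T_def by (rule Vector_Spaces.linear_compose[OF clinear_proj clinear_proj]) (rule M1 M2)+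
  interpret P: Vector_Spaces.linear scaleC scaleC "proj M1"
    by (rule clinear_proj[OF M1])
  have ST: "S y = proj M1 (T y)" for y
    by (simp add: S_def T_def)
  have norm_T: "(norm (T y))\<^sup>2 \<le> norm (S y) * norm y" for y
  proof -
    have "cinner (T y) (T y) = cinner (S y) y"
      using cinner_proj_left[OF M2, of "proj M1 y" "proj M1 y"]
        cinner_proj_adjoint[OF M1, of "T y" y] by (simp add: ST) (simp add: T_def)
    then have "(norm (T y))\<^sup>2 = cmod (cinner (S y) y)"
      unfolding cinner_self by (metis norm_of_real abs_of_nonneg zero_le_power2)
    then show ?thesis
      using cauchy_schwarz[of "S y" y] by simp
  qed
  define g where "g = (\<lambda>n. (c n * cinner x (h n)) *\<^sub>C h n)"
  define f where "f = (\<lambda>n. cinner x (h n) *\<^sub>C T (h n))"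
  have bound: "norm (sum f F - T x) \<le> sqrt (norm (sum g F - S x) * norm x)"
    if F: "finite F" "F \<subseteq> I" for F
  proof -
    define p where "p n = cinner x (h n) *\<^sub>C h n" for n
    define y where "y = x - sum p F"
    have "T (sum p F) = sum f F"
      unfolding T.sum f_def p_def T.scale ..
    then have Ty: "T y = T x - sum f F"
      by (simp add: y_def T.diff)
    have "S (sum p F) = sum g F"
      unfolding ST T.sum P.sum g_def p_def T.scale P.scale
      using F(2) eigen by (intro sum.cong refl) (auto simp: T_def scaleC_scaleC mult.commute)
    then have Sy: "S y = S x - sum g F"
      by (simp add: ST y_def T.diff P.diff)
    have "(norm y)\<^sup>2 = (norm x)\<^sup>2 - (\<Sum>n\<in>F. (norm (p n))\<^sup>2)"
      unfolding y_def
    proof (rule norm_diff_orthogonal_sum[OF F(1)])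
      fix n assume "n \<in> F"
      then have "cinner (h n) (h n) = 1"
        using F(2) orth by auto
      then have "cinner (p n) (p n) = cinner x (p n)"
        by (simp add: p_def cinner_scaleC_left cinner_scaleC_right)
      then show "cinner x (p n) = of_real ((norm (p n))\<^sup>2)"
        by (simp add: cinner_self)
    qed (use F(2) orth in \<open>auto simp: p_def cinner_scaleC_left cinner_scaleC_right subset_iff\<close>)
    also have "\<dots> \<le> (norm x)\<^sup>2"
      by (simp add: sum_nonneg)
    finally have "norm y \<le> norm x"
      by (rule power2_le_imp_le) simp
    then have "(norm (T y))\<^sup>2 \<le> norm (S y) * norm x"
      by (intro order_trans[OF norm_T] mult_left_mono) simp_all
    then show ?thesis
      unfolding Ty Sy norm_minus_commute[of _ "sum f F"] norm_minus_commute[of _ "sum g F"]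
      by (rule real_le_rsqrt)
  qed
  have "(sum g \<longlongrightarrow> S x) (finite_subsets_at_top I)"
    using diag by (simp add: has_sum_def S_def g_def)
  then have "((\<lambda>F. sqrt (norm (sum g F - S x) * norm x)) \<longlongrightarrow> sqrt (norm (S x - S x) * norm x))
      (finite_subsets_at_top I)"
    by (intro tendsto_intros)
  then have "((\<lambda>F. sqrt (norm (sum g F - S x) * norm x)) \<longlongrightarrow> 0) (finite_subsets_at_top I)"
    by simp
  then have "((\<lambda>F. sum f F - T x) \<longlongrightarrow> 0) (finite_subsets_at_top I)"
    by (rule Lim_null_comparison[rotated])
      (intro eventually_finite_subsets_at_top_weakI bound)
  then show ?thesis
    unfolding has_sum_def f_def[symmetric] T_def[symmetric] by (rule LIM_zero_cancel)
qed

text \<open>The basis vectors \<open>h n\<close> with nonzero eigenvalue lie in \<open>M1\<close> and span, together with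
  their companions, pairwise orthogonal blocks. The value at a unit vector \<open>x\<close> is the sum of its values on the
  blocks; the \<open>n\<close>-th of them is \<open>r n\<close> times a point of an ellipse, where \<open>r n\<close> is the squared norm of the
  component of \<open>x\<close> in the block. By Bessel's inequality this is an infinite subconvex combination.\<close>

lemma numerical_range_subset:
  assumes proper: "M1 \<noteq> UNIV \<or> M2 \<noteq> UNIV"
    and diag: "diagonalizable (proj M1 \<circ> proj M2 \<circ> proj M1)"
  shows "numerical_range (proj M2 \<circ> proj M1) \<subseteq>
    convex hull (\<Union>l\<in>{l. complex_of_real l \<in> point_spectrum (proj M2 \<circ> proj M1)}. elliptic_domain l)"
    (is "_ \<subseteq> convex hull ?E")
proof
  fix z assume "z \<in> numerical_range (proj M2 \<circ> proj M1)"
  then obtain x where x: "norm x = 1" "z = cinner (proj M2 (proj M1 x)) x"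
    by (auto simp: numerical_range_def)
  define S where "S = proj M1 \<circ> proj M2 \<circ> proj M1"
  obtain I h c where basis: "orthonormal_basis_on I h"
    and S: "\<And>x. ((\<lambda>n. (c n * cinner x (h n)) *\<^sub>C h n) has_sum S x) I"
    using diag unfolding diagonalizable_def S_def by blast
  have orth: "cinner (h m) (h n) = (if m = n then 1 else 0)" if "m \<in> I" "n \<in> I" for m n
    using basis that by (auto simp: orthonormal_basis_on_def)
  have norm_h: "norm (h n) = 1" if "n \<in> I" for n
  proof -
    have "complex_of_real ((norm (h n))\<^sup>2) = of_real 1"
      using orth[OF that that] by (simp add: cinner_self)
    then have "(norm (h n))\<^sup>2 = 1\<^sup>2"
      unfolding of_real_eq_iff by simp
    then show ?thesis
      by (rule power2_eq_imp_eq) simp_all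
  qed
  have eigenS: "S (h n) = c n *\<^sub>C h n" if n: "n \<in> I" for n
  proof (rule has_sum_unique[OF S])
    show "((\<lambda>m. (c m * cinner (h n) (h m)) *\<^sub>C h m) has_sum c n *\<^sub>C h n) I"
      by (rule has_sum_finite_neutralI[of "{n}"]) (use n orth in auto)
  qed
  \<comment> \<open>The scalars \<open>c n\<close> are nonnegative reals, since \<open>cinner (S y) y\<close> is a squared norm.\<close>
  define l where "l n = (norm (proj M2 (proj M1 (h n))))\<^sup>2" for n
  have c: "c n = of_real (l n)" if n: "n \<in> I" for n
  proof -
    have "cinner (S (h n)) (h n) = of_real (l n)"
      unfolding l_def cinner_self[symmetric] S_def
      using cinner_proj_adjoint[OF M1, of "proj M2 (proj M1 (h n))" "h n"]
        cinner_proj_left[OF M2, of "proj M1 (h n)" "proj M1 (h n)"] by simp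
    then show ?thesis
      by (simp add: eigenS[OF n] cinner_scaleC_left orth n)
  qed
  define J where "J = {n \<in> I. l n \<noteq> 0}"
  have hM: "h n \<in> M1" if n: "n \<in> J" for n
  proof -
    have "inverse (c n) *\<^sub>C S (h n) \<in> M1"
      using M1 proj_in[OF M1] by (simp add: S_def closed_csubspace_def complex_vector.subspace_scale)
    then show ?thesis
      using n by (simp add: J_def eigenS c scaleC_scaleC scaleC_one)
  qed
  have eigen: "proj M1 (proj M2 (h n)) = of_real (l n) *\<^sub>C h n" if n: "n \<in> J" for n
    using eigenS[of n] n by (simp add: S_def proj_id[OF M1 hM] c J_def)
  have normh: "norm (h n) = 1" if "n \<in> J" for n
    using norm_h that by (simp add: J_def)
  have range: "0 \<le> l n" "l n \<le> 1" if "n \<in> J" for n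
    using eigenvalue_range[OF hM normh eigen] that by auto
  have spec: "complex_of_real (l n) \<in> point_spectrum (proj M2 \<circ> proj M1)" if n: "n \<in> J" for n
  proof -
    have "proj M2 (h n) \<noteq> 0"
      using norm_proj_eigenvector[OF hM normh eigen, OF n n n] n by (auto simp: J_def)
    moreover have "proj M2 (proj M1 (proj M2 (h n))) = of_real (l n) *\<^sub>C proj M2 (h n)"
      by (simp add: eigen[OF n] proj_scaleC[OF M2])
    ultimately show ?thesis
      by (auto simp: point_spectrum_def)
  qed
  define k where "k n = companion M2 (l n) (h n)" for n
  define a where "a n = cinner x (h n)" for n
  define b where "b n = cinner x (k n)" for n
  define r where "r n = (cmod (a n))\<^sup>2 + (cmod (b n))\<^sup>2" for n
  have "((\<lambda>n. cinner (a n *\<^sub>C (proj M2 \<circ> proj M1) (h n)) x) has_sum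
      cinner ((proj M2 \<circ> proj M1) x) x) I"
    unfolding a_def
    by (rule has_sum_bounded_linear[OF bounded_linear_cinner_left
          proj_proj_series[OF orth eigenS[unfolded S_def] S[unfolded S_def]]])
  then have "((\<lambda>n. a n * cinner (proj M2 (proj M1 (h n))) x) has_sum z) I"
    by (simp add: cinner_scaleC_left x(2))
  moreover have "proj M2 (proj M1 (h n)) = 0" if "n \<in> I - J" for n
    using that by (simp add: J_def l_def)
  ultimately have series: "((\<lambda>n. a n * cinner (proj M2 (h n)) x) has_sum z) J"
    by (elim has_sum_cong_neutral[THEN iffD1, rotated -1]) (auto simp: J_def hM proj_id[OF M1])
  have "a n * cinner (proj M2 (h n)) x =
      of_real (l n * (cmod (a n))\<^sup>2) + of_real (sqrt (l n * (1 - l n))) * (a n * cnj (b n))"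
    if n: "n \<in> J" for n
    using cinner_commute[of "h n" x] cinner_commute[of "k n" x]
    by (simp add: proj_eigenvector_eq[OF hM normh eigen, OF n n n] cinner_scaleC_left
        cinner_add_left distrib_left complex_norm_square a_def b_def algebra_simps
        del: of_real_power flip: k_def)
  then have "\<exists>w\<in>elliptic_domain (l n). a n * cinner (proj M2 (h n)) x = r n *\<^sub>R w"
    if "n \<in> J" for n
    using scaled_elliptic_domain[OF range] that unfolding r_def by simp
  then obtain w where w: "\<And>n. n \<in> J \<Longrightarrow> w n \<in> elliptic_domain (l n)"
    and aw: "\<And>n. n \<in> J \<Longrightarrow> a n * cinner (proj M2 (h n)) x = r n *\<^sub>R w n"
    by metis
  have r_nonneg: "0 \<le> r n" for n
    by (simp add: r_def)
  have bessel: "sum r F \<le> 1" if F: "finite F" "F \<subseteq> J" for F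
  proof -
    \<comment> \<open>The component of \<open>x\<close> in the \<open>n\<close>-th block.\<close>
    define p where "p n = a n *\<^sub>C h n + b n *\<^sub>C k n" for n
    have hk: "cinner (h n) (k n) = 0" "cinner (k n) (h n) = 0" if "n \<in> J" for n
      using cinner_companion[OF hM normh eigen] that by (auto simp: k_def)
    \<comment> \<open>The companion is a unit vector or \<open>0\<close>, and in the latter case \<open>b n = 0\<close>.\<close>
    have kk: "b n * cinner (k n) (k n) = b n" if "n \<in> J" for n
      using norm_companion[OF hM normh eigen, OF that that that]
      by (auto simp: cinner_self k_def[symmetric] b_def split: if_splits)
    have cross: "cinner (h m) (k n) = 0" "cinner (k m) (h n) = 0" "cinner (k m) (k n) = 0"
      if "m \<in> J" "n \<in> J" "m \<noteq> n" for m n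
      using companion_orthogonal[OF eigen hM eigen hM, of m n] that orth[of m n]
      by (auto simp: k_def J_def)
    have xp: "cinner x (p n) = of_real (r n)" for n
      by (simp add: p_def cinner_add_right cinner_scaleC_right complex_norm_square r_def
          mult.commute flip: a_def b_def del: of_real_power)
    have pp: "cinner (p n) (p n) = of_real (r n)" if "n \<in> J" for n
      using that kk[OF that] orth[of n n] hk[OF that]
      by (simp add: p_def cinner_add_left cinner_add_right cinner_scaleC_left cinner_scaleC_right
          complex_norm_square r_def J_def mult.commute mult.left_commute del: of_real_power)
    have "(norm (x - sum p F))\<^sup>2 = (norm x)\<^sup>2 - (\<Sum>n\<in>F. (norm (p n))\<^sup>2)"
    proof (rule norm_diff_orthogonal_sum[OF F(1)])
      fix m n assume "m \<in> F" "n \<in> F" "m \<noteq> n"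
      moreover from this have "m \<in> J" "n \<in> J" "cinner (h m) (h n) = 0"
        using F(2) orth[of m n] by (auto simp: J_def)
      ultimately show "cinner (p m) (p n) = 0"
        by (simp add: p_def cross cinner_add_left cinner_add_right cinner_scaleC_left
            cinner_scaleC_right)
    next
      fix n assume "n \<in> F"
      then show "cinner x (p n) = of_real ((norm (p n))\<^sup>2)"
        using F(2) pp[of n] xp[of n] unfolding cinner_self by auto
    qed
    moreover have "(norm (p n))\<^sup>2 = r n" if "n \<in> J" for n
      using pp[OF that] unfolding cinner_self of_real_eq_iff .
    then have "(\<Sum>n\<in>F. (norm (p n))\<^sup>2) = sum r F"
      using F(2) by (intro sum.cong) auto
    ultimately show ?thesis
      using zero_le_power2[of "norm (x - sum p F)"] x(1) by simp
  qed
  then have "r summable_on J"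
    by (intro nonneg_bdd_above_summable_on) (auto simp: r_nonneg bdd_above_def)
  then obtain R where R: "(r has_sum R) J"
    unfolding summable_on_def by blast
  show "z \<in> convex hull ?E"
  proof (rule convex_infinite_subconvex_combination[OF convex_convex_hull _ _ R])
    have "0 \<in> ?E"
      using zero_in_point_spectrum[OF proper] by (auto intro!: bexI[of _ 0] simp: elliptic_domain_def)
    then show "0 \<in> convex hull ?E"
      by (rule hull_inc)
    show "R \<le> 1"
      by (rule has_sum_le_finite_sums[OF R bessel])
    show "w n \<in> convex hull ?E" if "n \<in> J" for n
      using w[OF that] spec[OF that] by (intro hull_inc) blast
    show "((\<lambda>n. r n *\<^sub>R w n) has_sum z) J"
      using series aw by (simp cong: has_sum_cong)
  qed (rule r_nonneg)
qed

end

theorem theorem1p3: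
  fixes M1 M2 :: "'a :: complex_hilbert_space set"
  assumes separable: "separable_space (euclidean :: 'a topology)"
    and M1: "closed_csubspace M1"
    and M2: "closed_csubspace M2"
    and proper: "M1 \<noteq> UNIV \<or> M2 \<noteq> UNIV"
    and diag: "diagonalizable (proj M1 \<circ> proj M2 \<circ> proj M1)"
  shows "numerical_range (proj M2 \<circ> proj M1) =
    convex hull (\<Union>l\<in>{l. complex_of_real l \<in> point_spectrum (proj M2 \<circ> proj M1)}.
      elliptic_domain l)"
proof
  show "numerical_range (proj M2 \<circ> proj M1) \<subseteq>
      convex hull (\<Union>l\<in>{l. complex_of_real l \<in> point_spectrum (proj M2 \<circ> proj M1)}. elliptic_domain l)"
    by (rule numerical_range_subset[OF M1 M2 proper diag])
  have "clinear (proj M2 \<circ> proj M1)"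
    by (rule Vector_Spaces.linear_compose[OF clinear_proj clinear_proj]) (rule M1 M2)+
  then show "convex hull (\<Union>l\<in>{l. complex_of_real l \<in> point_spectrum (proj M2 \<circ> proj M1)}.
      elliptic_domain l) \<subseteq> numerical_range (proj M2 \<circ> proj M1)"
    using elliptic_domain_subset_numerical_range[OF M1 M2 proper]
    by (intro hull_minimal UN_least Toeplitz_Hausdorff) auto
qed

end
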